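(* Let $T=T_1\cup\cdots\cup T_m$ be a theory over a many-sorted signature $\Sigma$, and let $F$ be a set of quantifier-free $\Sigma$-clauses and $A$ a set of equivalences $a\Leftrightarrow\forall\vec{x}\,\varphi$ (with $a$ a proxy Boolean variable), such that $(F,A)=\mathrm{purify}(\psi)$ for some $\Sigma$-formula $\psi$. Consider the procedure $\mathsf{FM\text{-}Solve}_{\mathcal{H}}(F,A)$ described in the context. Then: (1) If the method used in Step 1 for finding satisfying assignments for the current clause set is sound, then $\mathsf{FM\text{-}Solve}_{\mathcal{H}}(F,A)$ returns unsat only if $F\cup A$ is $T$-unsatisfiable. (2) If for all inputs $\mathcal{M}$ and $\forall\vec{x}\,\varphi$, $\mathcal{H}(\mathcal{M},\forall\vec{x}\,\varphi)$ returns the empty set only if $\mathcal{M}\models\forall\vec{x}\,\varphi$, then $\mathsf{FM\text{-}Solve}_{\mathcal{H}}(F,A)$ returns sat only if $F\cup A$ is $T$-satisfiable.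
   Context: Work in many-sorted first-order logic with equality; $\Sigma$ contains a sort $\mathsf{Bool}$ with distinct constants $\mathsf{true},\mathsf{false}$. A theory $T$ is a signature with a class of interpretations (its models); $T=T_1\cup\dots\cup T_m$ is the union of theories (models are the $\Sigma$-interpretations whose reducts are models of each $T_i$). Sorts occurring only in the theory of equality with uninterpreted functions are called uninterpreted. The input formulas $\psi$ are built from equalities of $\Sigma$-terms with $\wedge,\vee,\neg$ and $\forall x$, where each quantified variable has either an uninterpreted sort or a sort interpreted in every model of $T$ as a finite set of fixed cardinality. A satisfying assignment for a set of ground clauses $F$ is a $T$-satisfiable set $M$ of ground literals that propositionally entails $F$ (i.e. $M\cup\{\neg F\}$ is unsatisfiable when atoms are treated as propositional variables). A method for Step 1 is sound if it reports that no satisfying assignment exists only when $F$ is $T$-unsatisfiable. $\mathrm{purify}(\psi)=(F,A)$ is computed as follows: convert $\psi$ to clausal form treating quantified subformulas as atoms; then each quantified formula $\forall\vec{x}\,\varphi$ occurring in a clause is replaced by a fresh Boolean proxy variable $a$ (and $a\Leftrightarrow\forall\vec{x}\,\varphi$, i.e. $a\approx\mathsf{true}\Leftrightarrow\forall\vec x\,\varphi$, is added to $A$) if it occurs positively, and by $\varphi\{\vec{x}\mapsto\vec{k}\}$ with fresh variables $\vec{k}$ (Skolem-like) if it occurs negatively; this is repeated until $F$ is quantifier-free. The result is equisatisfiable with $\psi$ in $T$; purify is applied to sets of formulas analogously. Procedure $\mathsf{FM\text{-}Solve}_{\mathcal{H}}(F,A)$, parametrized by a quantifier instantiation heuristic $\mathcal{H}$: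 Step 1: find a satisfying assignment $M$ for $F$; if none is found return unsat. Step 2: construct a $\Sigma$-interpretation $\mathcal{M}$ satisfying $M$ which interprets uninterpreted sorts as finite sets, and let $\mathbf{V}$ be a minimal set of $\Sigma$-terms such that for every uninterpreted sort $S$ every element of $S^{\mathcal{M}}$ is the value in $\mathcal{M}$ of some term in $\mathbf{V}$. Step 3: for each $\forall\vec{x}\,\varphi$ with $(a\Leftrightarrow\forall\vec{x}\,\varphi)\in A$ and $a\in M$, let $\Theta$ be the set of substitutions from $\vec x$ to terms in $\mathbf V$ chosen by $\mathcal{H}(\mathcal{M},\forall\vec{x}\,\varphi)$, and update $(F,A):=(F\cup F',A\cup A')$ where $(F',A')=\mathrm{purify}(\{\neg a\vee\varphi\sigma\mid\sigma\in\Theta\})$. If all these sets $\Theta$ were empty, return sat; otherwise go to Step 1.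
   Formalization: In Step 2 the interpretation satisfying M is required to be a model of T, not merely a Σ-interpretation; otherwise part (2) fails, e.g. for ∀x. f(x)<f(x) over the integers with an interpretation that makes < always true. *)

theory Defs
  imports Main
begin

datatype 's srt = BoolS | Srt 's
datatype 'f fsym = TrueC | FalseC | Fn 'f

record ('s, 'f) sign =
  sorts :: "'s srt set"
  rank :: "'f fsym \<rightharpoonup> 's srt list \<times> 's srt"

definition is_sign :: "('s, 'f) sign \<Rightarrow> bool" where
  "is_sign \<Sigma> \<longleftrightarrow>
     (\<forall>f ss s. rank \<Sigma> f = Some (ss, s) \<longrightarrow> set ss \<subseteq> sorts \<Sigma> \<and> s \<in> sorts \<Sigma>) \<and>
     rank \<Sigma> TrueC \<in> {None, Some ([], BoolS)} \<and>
     rank \<Sigma> FalseC \<in> {None, Some ([], BoolS)}"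

definition has_bool :: "('s, 'f) sign \<Rightarrow> bool" where
  "has_bool \<Sigma> \<longleftrightarrow> BoolS \<in> sorts \<Sigma> \<and>
     rank \<Sigma> TrueC = Some ([], BoolS) \<and> rank \<Sigma> FalseC = Some ([], BoolS)"

record ('s, 'f, 'u) struct =
  univ :: "'s srt \<Rightarrow> 'u set"
  fint :: "'f fsym \<Rightarrow> 'u list \<Rightarrow> 'u"

definition sorted_tuple :: "('s, 'f, 'u) struct \<Rightarrow> 's srt list \<Rightarrow> 'u list \<Rightarrow> bool" where
  "sorted_tuple S ss us \<longleftrightarrow> list_all2 (\<lambda>u s. u \<in> univ S s) us ss"

text \<open>A structure is fixed to \<open>{}\<close> and \<open>undefined\<close> outside its signature, so that reducts can be
  compared by equality.\<close>

definition is_struct :: "('s, 'f) sign \<Rightarrow> ('s, 'f, 'u) struct \<Rightarrow> bool" where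
  "is_struct \<Sigma> S \<longleftrightarrow>
     (\<forall>s. s \<in> sorts \<Sigma> \<longleftrightarrow> univ S s \<noteq> {}) \<and>
     (\<forall>f ss s us. rank \<Sigma> f = Some (ss, s) \<longrightarrow> sorted_tuple S ss us \<longrightarrow> fint S f us \<in> univ S s) \<and>
     (\<forall>f ss s us. rank \<Sigma> f = Some (ss, s) \<longrightarrow> \<not> sorted_tuple S ss us \<longrightarrow> fint S f us = undefined) \<and>
     (\<forall>f us. rank \<Sigma> f = None \<longrightarrow> fint S f us = undefined) \<and>
     (has_bool \<Sigma> \<longrightarrow> fint S TrueC [] \<noteq> fint S FalseC [])"

definition reduct :: "('s, 'f) sign \<Rightarrow> ('s, 'f, 'u) struct \<Rightarrow> ('s, 'f, 'u) struct" where
  "reduct \<Sigma> S =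
     \<lparr>univ = (\<lambda>s. if s \<in> sorts \<Sigma> then univ S s else {}),
      fint = (\<lambda>f us. if f \<in> dom (rank \<Sigma>) then fint S f us else undefined)\<rparr>"

text \<open>An interpretation is a structure together with an assignment of the free variables. A theory
  is given by a class of structures; its class of interpretations is thereby closed under
  reassignment of variables.\<close>

record ('s, 'f, 'u) thry =
  sig :: "('s, 'f) sign"
  models :: "('s, 'f, 'u) struct set"

definition is_thry :: "('s, 'f, 'u) thry \<Rightarrow> bool" where
  "is_thry T \<longleftrightarrow> is_sign (sig T) \<and> (\<forall>S \<in> models T. is_struct (sig T) S)"

definition compatible :: "('s, 'f, 'u) thry list \<Rightarrow> bool" where
  "compatible Ts \<longleftrightarrow>
     (\<forall>T \<in> set Ts. \<forall>T' \<in> set Ts. \<forall>f \<in> dom (rank (sig T)) \<inter> dom (rank (sig T')).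
        rank (sig T) f = rank (sig T') f)"

definition sign_union :: "('s, 'f, 'u) thry list \<Rightarrow> ('s, 'f) sign" where
  "sign_union Ts =
     \<lparr>sorts = (\<Union>T \<in> set Ts. sorts (sig T)),
      rank = foldr (\<lambda>T m. rank (sig T) ++ m) Ts Map.empty\<rparr>"

definition thry_union :: "('s, 'f, 'u) thry list \<Rightarrow> ('s, 'f, 'u) thry" where
  "thry_union Ts =
     \<lparr>sig = sign_union Ts,
      models = {S. is_struct (sign_union Ts) S \<and> (\<forall>T \<in> set Ts. reduct (sig T) S \<in> models T)}\<rparr>"

definition is_EUF :: "('s, 'f, 'u) thry \<Rightarrow> bool" where
  "is_EUF T \<longleftrightarrow> models T = {S. is_struct (sig T) S}"

definition uninterpreted :: "('s, 'f, 'u) thry list \<Rightarrow> 's srt set" where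
  "uninterpreted Ts =
     {s. s \<in> sorts (sign_union Ts) \<and> s \<noteq> BoolS \<and>
         (\<forall>T \<in> set Ts. s \<in> sorts (sig T) \<longrightarrow> is_EUF T)}"

definition fixed_finite :: "('s, 'f, 'u) thry \<Rightarrow> 's srt \<Rightarrow> bool" where
  "fixed_finite T s \<longleftrightarrow> (\<exists>n. \<forall>S \<in> models T. finite (univ S s) \<and> card (univ S s) = n)"

text \<open>Free variables are named and carry their sort; bound variables are de Bruijn indices.
  \<open>FAll [s\<^sub>1, \<dots>, s\<^sub>n] \<phi>\<close> is a block \<open>\<forall>x\<^sub>1\<dots>x\<^sub>n. \<phi>\<close>: directly below it, \<open>Bnd (i - 1)\<close> is \<open>x\<^sub>i\<close>, and the
  indices from \<open>n\<close> on refer to the enclosing blocks. Terms without bound variables are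
  the ground terms; free variables act as constants there.\<close>

type_synonym 's var = "nat \<times> 's srt"

datatype ('s, 'f) tm = Free "'s var" | Bnd nat | App "'f fsym" "('s, 'f) tm list"

datatype ('s, 'f) form =
    FEq "('s, 'f) tm" "('s, 'f) tm"
  | FNot "('s, 'f) form"
  | FAnd "('s, 'f) form" "('s, 'f) form"
  | FOr "('s, 'f) form" "('s, 'f) form"
  | FAll "'s srt list" "('s, 'f) form"

inductive has_sort :: "('s, 'f) sign \<Rightarrow> 's srt list \<Rightarrow> ('s, 'f) tm \<Rightarrow> 's srt \<Rightarrow> bool"
  for \<Sigma> \<Gamma> where
  "s \<in> sorts \<Sigma> \<Longrightarrow> has_sort \<Sigma> \<Gamma> (Free (n, s)) s"
| "i < length \<Gamma> \<Longrightarrow> has_sort \<Sigma> \<Gamma> (Bnd i) (\<Gamma> ! i)"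
| "rank \<Sigma> f = Some (ss, s) \<Longrightarrow> list_all2 (has_sort \<Sigma> \<Gamma>) ts ss \<Longrightarrow> has_sort \<Sigma> \<Gamma> (App f ts) s"

text \<open>\<open>Q\<close> is the set of sorts over which quantification is allowed.\<close>

fun wf_form :: "('s, 'f) sign \<Rightarrow> 's srt set \<Rightarrow> 's srt list \<Rightarrow> ('s, 'f) form \<Rightarrow> bool" where
  "wf_form \<Sigma> Q \<Gamma> (FEq t u) \<longleftrightarrow> (\<exists>s. has_sort \<Sigma> \<Gamma> t s \<and> has_sort \<Sigma> \<Gamma> u s)"
| "wf_form \<Sigma> Q \<Gamma> (FNot \<phi>) \<longleftrightarrow> wf_form \<Sigma> Q \<Gamma> \<phi>"
| "wf_form \<Sigma> Q \<Gamma> (FAnd \<phi> \<chi>) \<longleftrightarrow> wf_form \<Sigma> Q \<Gamma> \<phi> \<and> wf_form \<Sigma> Q \<Gamma> \<chi>"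
| "wf_form \<Sigma> Q \<Gamma> (FOr \<phi> \<chi>) \<longleftrightarrow> wf_form \<Sigma> Q \<Gamma> \<phi> \<and> wf_form \<Sigma> Q \<Gamma> \<chi>"
| "wf_form \<Sigma> Q \<Gamma> (FAll ss \<phi>) \<longleftrightarrow>
     ss \<noteq> [] \<and> set ss \<subseteq> sorts \<Sigma> \<inter> Q \<and> wf_form \<Sigma> Q (ss @ \<Gamma>) \<phi>"

definition quant_sorts :: "('s, 'f, 'u) thry list \<Rightarrow> 's srt set" where
  "quant_sorts Ts = {s. s \<in> uninterpreted Ts \<or> fixed_finite (thry_union Ts) s}"

definition input_form :: "('s, 'f, 'u) thry list \<Rightarrow> ('s, 'f) form \<Rightarrow> bool" where
  "input_form Ts \<psi> \<longleftrightarrow> wf_form (sign_union Ts) (quant_sorts Ts) [] \<psi>"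

primrec fv_tm :: "('s, 'f) tm \<Rightarrow> 's var set" where
  "fv_tm (Free x) = {x}"
| "fv_tm (Bnd i) = {}"
| "fv_tm (App f ts) = \<Union> (set (map fv_tm ts))"

primrec fv :: "('s, 'f) form \<Rightarrow> 's var set" where
  "fv (FEq t u) = fv_tm t \<union> fv_tm u"
| "fv (FNot \<phi>) = fv \<phi>"
| "fv (FAnd \<phi> \<chi>) = fv \<phi> \<union> fv \<chi>"
| "fv (FOr \<phi> \<chi>) = fv \<phi> \<union> fv \<chi>"
| "fv (FAll ss \<phi>) = fv \<phi>"

text \<open>\<open>inst 0 ts \<phi>\<close> is \<open>\<phi>{x\<^sub>1 \<mapsto> t\<^sub>1, \<dots>, x\<^sub>n \<mapsto> t\<^sub>n}\<close> for the body \<open>\<phi>\<close> of a block; the \<open>ts\<close> are meant to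
  be free of bound variables, so no lifting is needed. \<open>d\<close> counts the bound variables in between.\<close>

primrec inst_tm :: "nat \<Rightarrow> ('s, 'f) tm list \<Rightarrow> ('s, 'f) tm \<Rightarrow> ('s, 'f) tm" where
  "inst_tm d ts (Free x) = Free x"
| "inst_tm d ts (Bnd i) =
     (if i < d then Bnd i else if i < d + length ts then ts ! (i - d) else Bnd (i - length ts))"
| "inst_tm d ts (App f us) = App f (map (inst_tm d ts) us)"

primrec inst :: "nat \<Rightarrow> ('s, 'f) tm list \<Rightarrow> ('s, 'f) form \<Rightarrow> ('s, 'f) form" where
  "inst d ts (FEq t u) = FEq (inst_tm d ts t) (inst_tm d ts u)"
| "inst d ts (FNot \<phi>) = FNot (inst d ts \<phi>)"
| "inst d ts (FAnd \<phi> \<chi>) = FAnd (inst d ts \<phi>) (inst d ts \<chi>)"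
| "inst d ts (FOr \<phi> \<chi>) = FOr (inst d ts \<phi>) (inst d ts \<chi>)"
| "inst d ts (FAll ss \<phi>) = FAll ss (inst (d + length ss) ts \<phi>)"

type_synonym ('s, 'f, 'u) interp = "('s, 'f, 'u) struct \<times> ('s var \<Rightarrow> 'u)"

definition is_interp :: "('s, 'f, 'u) thry \<Rightarrow> ('s, 'f, 'u) interp \<Rightarrow> bool" where
  "is_interp T I \<longleftrightarrow> fst I \<in> models T \<and>
     (\<forall>n. \<forall>s \<in> sorts (sig T). snd I (n, s) \<in> univ (fst I) s)"

primrec eval :: "('s, 'f, 'u) interp \<Rightarrow> 'u list \<Rightarrow> ('s, 'f) tm \<Rightarrow> 'u" where
  "eval I e (Free x) = snd I x"
| "eval I e (Bnd i) = e ! i"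
| "eval I e (App f ts) = fint (fst I) f (map (eval I e) ts)"

primrec holds :: "('s, 'f, 'u) interp \<Rightarrow> 'u list \<Rightarrow> ('s, 'f) form \<Rightarrow> bool" where
  "holds I e (FEq t u) \<longleftrightarrow> eval I e t = eval I e u"
| "holds I e (FNot \<phi>) \<longleftrightarrow> \<not> holds I e \<phi>"
| "holds I e (FAnd \<phi> \<chi>) \<longleftrightarrow> holds I e \<phi> \<and> holds I e \<chi>"
| "holds I e (FOr \<phi> \<chi>) \<longleftrightarrow> holds I e \<phi> \<or> holds I e \<chi>"
| "holds I e (FAll ss \<phi>) \<longleftrightarrow> (\<forall>us. sorted_tuple (fst I) ss us \<longrightarrow> holds I (us @ e) \<phi>)"

abbreviation sat :: "('s, 'f, 'u) interp \<Rightarrow> ('s, 'f) form \<Rightarrow> bool" where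
  "sat I \<phi> \<equiv> holds I [] \<phi>"

text \<open>The atoms of literals are equalities and quantified formulas.\<close>

datatype 'a literal = Pos (atm: 'a) | Neg (atm: 'a)

type_synonym ('s, 'f) clause = "('s, 'f) form literal set"

primrec lit_true :: "('a \<Rightarrow> bool) \<Rightarrow> 'a literal \<Rightarrow> bool" where
  "lit_true v (Pos p) \<longleftrightarrow> v p"
| "lit_true v (Neg p) \<longleftrightarrow> \<not> v p"

definition clauses_true :: "('a \<Rightarrow> bool) \<Rightarrow> 'a literal set set \<Rightarrow> bool" where
  "clauses_true v F \<longleftrightarrow> (\<forall>c \<in> F. \<exists>l \<in> c. lit_true v l)"

primrec atoms :: "('s, 'f) form \<Rightarrow> ('s, 'f) form set" where
  "atoms (FEq t u) = {FEq t u}"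
| "atoms (FNot \<phi>) = atoms \<phi>"
| "atoms (FAnd \<phi> \<chi>) = atoms \<phi> \<union> atoms \<chi>"
| "atoms (FOr \<phi> \<chi>) = atoms \<phi> \<union> atoms \<chi>"
| "atoms (FAll ss \<phi>) = {FAll ss \<phi>}"

primrec prop_true :: "(('s, 'f) form \<Rightarrow> bool) \<Rightarrow> ('s, 'f) form \<Rightarrow> bool" where
  "prop_true v (FEq t u) \<longleftrightarrow> v (FEq t u)"
| "prop_true v (FNot \<phi>) \<longleftrightarrow> \<not> prop_true v \<phi>"
| "prop_true v (FAnd \<phi> \<chi>) \<longleftrightarrow> prop_true v \<phi> \<and> prop_true v \<chi>"
| "prop_true v (FOr \<phi> \<chi>) \<longleftrightarrow> prop_true v \<phi> \<or> prop_true v \<chi>"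
| "prop_true v (FAll ss \<phi>) \<longleftrightarrow> v (FAll ss \<phi>)"

text \<open>\<open>C\<close> is a clausal form of the set \<open>\<Phi>\<close>, quantified subformulas being treated as atoms. No particular
  conversion is fixed: any finite set of finite clauses over the same atoms that is propositionally
  equivalent to \<open>\<Phi>\<close> qualifies.\<close>

definition clausal_form :: "('s, 'f) form set \<Rightarrow> ('s, 'f) clause set \<Rightarrow> bool" where
  "clausal_form \<Phi> C \<longleftrightarrow>
     finite C \<and> (\<forall>c \<in> C. finite c) \<and> atm ` \<Union>C \<subseteq> \<Union> (atoms ` \<Phi>) \<and>
     (\<forall>v. clauses_true v C \<longleftrightarrow> (\<forall>\<phi> \<in> \<Phi>. prop_true v \<phi>))"

definition is_quantified :: "('s, 'f) form \<Rightarrow> bool" where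
  "is_quantified \<phi> \<longleftrightarrow> (\<exists>ss \<chi>. \<phi> = FAll ss \<chi>)"

definition ground_literal :: "('s, 'f) sign \<Rightarrow> ('s, 'f) form literal \<Rightarrow> bool" where
  "ground_literal \<Sigma> l \<longleftrightarrow>
     (\<exists>t u s. atm l = FEq t u \<and> has_sort \<Sigma> [] t s \<and> has_sort \<Sigma> [] u s)"

definition ground_clauses :: "('s, 'f) sign \<Rightarrow> ('s, 'f) clause set \<Rightarrow> bool" where
  "ground_clauses \<Sigma> F \<longleftrightarrow>
     finite F \<and> (\<forall>c \<in> F. finite c \<and> (\<forall>l \<in> c. ground_literal \<Sigma> l))"

abbreviation sat_lit :: "('s, 'f, 'u) interp \<Rightarrow> ('s, 'f) form literal \<Rightarrow> bool" where
  "sat_lit I \<equiv> lit_true (sat I)"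

abbreviation sat_clauses :: "('s, 'f, 'u) interp \<Rightarrow> ('s, 'f) clause set \<Rightarrow> bool" where
  "sat_clauses I \<equiv> clauses_true (sat I)"

definition satisfying_assignment ::
  "('s, 'f, 'u) thry \<Rightarrow> ('s, 'f) form literal set \<Rightarrow> ('s, 'f) clause set \<Rightarrow> bool" where
  "satisfying_assignment T M F \<longleftrightarrow>
     (\<forall>l \<in> M. ground_literal (sig T) l) \<and>
     (\<exists>I. is_interp T I \<and> (\<forall>l \<in> M. sat_lit I l)) \<and>
     (\<forall>v. (\<forall>l \<in> M. lit_true v l) \<longrightarrow> clauses_true v F)"

text \<open>\<open>(a, q) \<in> A\<close> stands for the equivalence \<open>a \<Leftrightarrow> q\<close>, i.e. \<open>a \<approx> true \<Leftrightarrow> q\<close>.\<close>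

type_synonym ('s, 'f) defs = "('s var \<times> ('s, 'f) form) set"

definition proxy :: "'s var \<Rightarrow> ('s, 'f) form" where
  "proxy a = FEq (Free a) (App TrueC [])"

definition sat_defs :: "('s, 'f, 'u) interp \<Rightarrow> ('s, 'f) defs \<Rightarrow> bool" where
  "sat_defs I A \<longleftrightarrow> (\<forall>(a, q) \<in> A. sat I (proxy a) \<longleftrightarrow> sat I q)"

definition T_satisfiable_clauses :: "('s, 'f, 'u) thry \<Rightarrow> ('s, 'f) clause set \<Rightarrow> bool" where
  "T_satisfiable_clauses T F \<longleftrightarrow> (\<exists>I. is_interp T I \<and> sat_clauses I F)"

definition T_satisfiable ::
  "('s, 'f, 'u) thry \<Rightarrow> ('s, 'f) clause set \<Rightarrow> ('s, 'f) defs \<Rightarrow> bool" where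
  "T_satisfiable T F A \<longleftrightarrow> (\<exists>I. is_interp T I \<and> sat_clauses I F \<and> sat_defs I A)"

definition fv_clauses :: "('s, 'f) clause set \<Rightarrow> 's var set" where
  "fv_clauses F = (\<Union>c \<in> F. \<Union>l \<in> c. fv (atm l))"

definition fv_defs :: "('s, 'f) defs \<Rightarrow> 's var set" where
  "fv_defs A = (\<Union>(a, q) \<in> A. insert a (fv q))"

text \<open>One replacement step on \<open>(U, F, A)\<close>, where \<open>U\<close> collects all variables used so far. The set \<open>G\<close>
  contains the clauses in which the occurrence of the quantified formula is replaced; taking
  \<open>G\<close> to be a singleton introduces fresh variables per occurrence, taking it to be all clauses with
  such an occurrence shares them. In the negative case the disjunct \<open>\<not> \<phi>{x \<mapsto> k}\<close>
  is turned into clauses \<open>D\<close>, which are distributed over the rest of the clause.\<close>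

inductive purify_step ::
  "'s var set \<times> ('s, 'f) clause set \<times> ('s, 'f) defs \<Rightarrow>
   's var set \<times> ('s, 'f) clause set \<times> ('s, 'f) defs \<Rightarrow> bool" where
  positive:
  "G \<subseteq> F \<Longrightarrow> G \<noteq> {} \<Longrightarrow> \<forall>c \<in> G. Pos (FAll ss \<phi>) \<in> c \<Longrightarrow>
   a = (n, BoolS) \<Longrightarrow> a \<notin> U \<Longrightarrow>
   purify_step (U, F, A)
     (insert a U,
      (F - G) \<union> {insert (Pos (proxy a)) (c - {Pos (FAll ss \<phi>)}) | c. c \<in> G},
      insert (a, FAll ss \<phi>) A)"
| negative:
  "G \<subseteq> F \<Longrightarrow> G \<noteq> {} \<Longrightarrow> \<forall>c \<in> G. Neg (FAll ss \<phi>) \<in> c \<Longrightarrow>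
   map snd ks = ss \<Longrightarrow> distinct ks \<Longrightarrow> set ks \<inter> U = {} \<Longrightarrow>
   clausal_form {FNot (inst 0 (map Free ks) \<phi>)} D \<Longrightarrow>
   purify_step (U, F, A)
     (set ks \<union> U,
      (F - G) \<union> {(c - {Neg (FAll ss \<phi>)}) \<union> d | c d. c \<in> G \<and> d \<in> D},
      A)"

text \<open>\<open>purify X \<Phi> F A\<close>: \<open>(F, A)\<close> is a result of \<open>purify \<Phi>\<close>, the variables introduced being fresh also
  with respect to \<open>X\<close>.\<close>

definition purify ::
  "'s var set \<Rightarrow> ('s, 'f) form set \<Rightarrow> ('s, 'f) clause set \<Rightarrow> ('s, 'f) defs \<Rightarrow> bool" where
  "purify X \<Phi> F A \<longleftrightarrow>
     (\<exists>C U. clausal_form \<Phi> C \<and>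
        purify_step\<^sup>*\<^sup>* (X \<union> \<Union> (fv ` \<Phi>), C, {}) (U, F, A) \<and>
        (\<forall>c \<in> F. \<forall>l \<in> c. \<not> is_quantified (atm l)))"

definition covering_terms ::
  "('s, 'f, 'u) thry list \<Rightarrow> ('s, 'f, 'u) interp \<Rightarrow> ('s, 'f) tm set \<Rightarrow> bool" where
  "covering_terms Ts I V \<longleftrightarrow>
     (\<forall>t \<in> V. \<exists>s. has_sort (sign_union Ts) [] t s) \<and>
     (\<forall>s \<in> uninterpreted Ts. \<forall>u \<in> univ (fst I) s.
        \<exists>t \<in> V. has_sort (sign_union Ts) [] t s \<and> eval I [] t = u)"

text \<open>The pairs of an interpretation and a set of terms that Step 2 may produce; the requirement
  that the interpretation satisfy the current assignment is separate.\<close>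

definition step2_result ::
  "('s, 'f, 'u) thry list \<Rightarrow> ('s, 'f, 'u) interp \<Rightarrow> ('s, 'f) tm set \<Rightarrow> bool" where
  "step2_result Ts I V \<longleftrightarrow>
     is_interp (thry_union Ts) I \<and> (\<forall>s \<in> uninterpreted Ts. finite (univ (fst I) s)) \<and>
     covering_terms Ts I V \<and> (\<forall>V'. V' \<subset> V \<longrightarrow> \<not> covering_terms Ts I V')"

text \<open>A substitution for a block with sorts \<open>ss\<close> is the list of the terms replacing its variables. As
  these terms are taken from \<open>V\<close>, a heuristic is passed \<open>V\<close> along with the interpretation.\<close>

definition substs ::
  "('s, 'f) sign \<Rightarrow> ('s, 'f) tm set \<Rightarrow> 's srt list \<Rightarrow> ('s, 'f) tm list set" where
  "substs \<Sigma> V ss = {ts. set ts \<subseteq> V \<and> list_all2 (has_sort \<Sigma> []) ts ss}"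

type_synonym ('s, 'f, 'u) heuristic =
  "('s, 'f, 'u) interp \<Rightarrow> ('s, 'f) tm set \<Rightarrow> ('s, 'f) form \<Rightarrow> ('s, 'f) tm list set"

definition empty_only_if_true ::
  "('s, 'f, 'u) thry list \<Rightarrow> ('s, 'f, 'u) heuristic \<Rightarrow> bool" where
  "empty_only_if_true Ts H \<longleftrightarrow>
     (\<forall>I V ss \<phi>. step2_result Ts I V \<longrightarrow> input_form Ts (FAll ss \<phi>) \<longrightarrow>
        H I V (FAll ss \<phi>) = {} \<longrightarrow> sat I (FAll ss \<phi>))"

text \<open>\<open>step1 F None\<close>: the method may report that \<open>F\<close> has no satisfying assignment;
  \<open>step1 F (Some M)\<close>: it may return \<open>M\<close>.\<close>

type_synonym ('s, 'f) step1_method =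
  "('s, 'f) clause set \<Rightarrow> ('s, 'f) form literal set option \<Rightarrow> bool"

definition sound_step1 ::
  "('s, 'f, 'u) thry \<Rightarrow> ('s, 'f) step1_method \<Rightarrow> bool" where
  "sound_step1 T step1 \<longleftrightarrow>
     (\<forall>F. ground_clauses (sig T) F \<longrightarrow> step1 F None \<longrightarrow> \<not> T_satisfiable_clauses T F)"

definition active :: "('s, 'f) defs \<Rightarrow> ('s, 'f) form literal set \<Rightarrow> ('s, 'f) defs" where
  "active A M = {(a, q) \<in> A. Pos (proxy a) \<in> M}"

text \<open>\<open>P\<close> holds the equivalences still to be processed.\<close>

inductive step3 ::
  "('s, 'f) sign \<Rightarrow> ('s, 'f) tm set \<Rightarrow> (('s, 'f) form \<Rightarrow> ('s, 'f) tm list set) \<Rightarrow> ('s, 'f) defs \<Rightarrow>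
   ('s, 'f) clause set \<times> ('s, 'f) defs \<Rightarrow> ('s, 'f) clause set \<times> ('s, 'f) defs \<Rightarrow> bool"
  for \<Sigma> V h where
  "step3 \<Sigma> V h {} (F, A) (F, A)"
| "(a, FAll ss \<phi>) \<in> P \<Longrightarrow>
   h (FAll ss \<phi>) = \<Theta> \<Longrightarrow> \<Theta> \<subseteq> substs \<Sigma> V ss \<Longrightarrow>
   purify (fv_clauses F \<union> fv_defs A) {FOr (FNot (proxy a)) (inst 0 \<sigma> \<phi>) | \<sigma>. \<sigma> \<in> \<Theta>} F' A' \<Longrightarrow>
   step3 \<Sigma> V h (P - {(a, FAll ss \<phi>)}) (F \<union> F', A \<union> A') (F'', A'') \<Longrightarrow>
   step3 \<Sigma> V h P (F, A) (F'', A'')"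

datatype answer = Sat | Unsat

text \<open>\<open>FM_Solve Ts step1 H F A r\<close>: some run on \<open>(F, A)\<close> terminates and returns \<open>r\<close>.\<close>

inductive FM_Solve ::
  "('s, 'f, 'u) thry list \<Rightarrow> ('s, 'f) step1_method \<Rightarrow> ('s, 'f, 'u) heuristic \<Rightarrow>
   ('s, 'f) clause set \<Rightarrow> ('s, 'f) defs \<Rightarrow> answer \<Rightarrow> bool"
  for Ts step1 H where
  unsat:
  "step1 F None \<Longrightarrow> FM_Solve Ts step1 H F A Unsat"
| sat:
  "step1 F (Some M) \<Longrightarrow> satisfying_assignment (thry_union Ts) M F \<Longrightarrow>
   step2_result Ts I V \<Longrightarrow> \<forall>l \<in> M. sat_lit I l \<Longrightarrow>
   \<forall>(a, q) \<in> active A M. H I V q = {} \<Longrightarrow>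
   FM_Solve Ts step1 H F A Sat"
| loop:
  "step1 F (Some M) \<Longrightarrow> satisfying_assignment (thry_union Ts) M F \<Longrightarrow>
   step2_result Ts I V \<Longrightarrow> \<forall>l \<in> M. sat_lit I l \<Longrightarrow>
   \<exists>(a, q) \<in> active A M. H I V q \<noteq> {} \<Longrightarrow>
   step3 (sign_union Ts) V (H I V) (active A M) (F, A) (F', A') \<Longrightarrow>
   FM_Solve Ts step1 H F' A' r \<Longrightarrow>
   FM_Solve Ts step1 H F A r"

end

theory Submission
  imports Defs
begin

text \<open>Unsat: reinterpreting only the fresh variables turns a model of the input of \<open>purify\<close>
  into a model of its output, so every round of the procedure preserves satisfiability of
  \<open>F \<union> A\<close>.

  Sat: the clauses only grow, so the final assignment \<open>M\<close> still entails the initial clauses. In the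
  initial \<open>(F, A)\<close> a proxy occurs only in literals \<open>Pos (proxy a)\<close>, hence every
  non-tautological clause of \<open>F\<close> contains a member of \<open>M\<close> that is either free of proxies or is an active
  proxy, whose quantified formula then holds. Reassigning each proxy the truth
  value of its formula therefore gives a model of \<open>F \<union> A\<close>, although the literals in \<open>M\<close>, and the
  clauses added later, may mention proxies elsewhere and become false.\<close>

section \<open>Substitution and free variables\<close>

lemma sorted_tuple_length: "sorted_tuple S ss us \<Longrightarrow> length us = length ss"
  unfolding sorted_tuple_def by (rule list_all2_lengthD)

lemma eval_closed: "has_sort \<Sigma> [] t s \<Longrightarrow> eval I e t = eval I [] t"
proof (induction rule: has_sort.induct)
  case (3 f ss s ts)
  then have "\<forall>t \<in> set ts. eval I e t = eval I [] t"
    by (auto simp: list_all2_conv_all_nth in_set_conv_nth)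
  then show ?case by (simp cong: map_cong)
qed auto

lemma has_sort_weaken: "has_sort \<Sigma> [] t s \<Longrightarrow> has_sort \<Sigma> \<Gamma> t s"
proof (induction rule: has_sort.induct)
  case (3 f ss s ts)
  then show ?case by (auto intro!: has_sort.intros elim: list_all2_mono)
qed (auto intro: has_sort.intros)

text \<open>\<open>\<Delta>\<close> lists the blocks between the instantiated one and the current
  position; it is what lets an induction pass below binders. A closed \<open>ts\<close> entry keeps
  its sort in every context, so no lifting occurs.\<close>

lemma has_sort_inst_tm:
  assumes "has_sort \<Sigma> (\<Delta> @ ss @ \<Gamma>) t s" "list_all2 (has_sort \<Sigma> []) ts ss"
  shows "has_sort \<Sigma> (\<Delta> @ \<Gamma>) (inst_tm (length \<Delta>) ts t) s"
  using assms(1)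
proof (induction rule: has_sort.induct)
  case (1 s n)
  then show ?case by (auto intro: has_sort.intros)
next
  case (2 i)
  have len: "length ts = length ss" using assms(2) by (rule list_all2_lengthD)
  consider "i < length \<Delta>" | "length \<Delta> \<le> i" "i < length \<Delta> + length ss" | "length \<Delta> + length ss \<le> i"
    by linarith
  then show ?case
  proof cases
    case 1
    then show ?thesis using has_sort.intros(2)[of i "\<Delta> @ \<Gamma>" \<Sigma>] by (simp add: nth_append)
  next
    case 2
    then have "has_sort \<Sigma> [] (ts ! (i - length \<Delta>)) (ss ! (i - length \<Delta>))"
      using assms(2) by (auto simp: list_all2_conv_all_nth)
    moreover have "i - length \<Delta> < length ss" using 2 by simp
    ultimately show ?thesis using 2 len by (simp add: nth_append has_sort_weaken)
  next
    \<comment> \<open>An index beyond the removed block still denotes the same variable of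
      \<open>\<Gamma>\<close>, now \<open>length ss\<close> places lower.\<close>
    case 3
    have "has_sort \<Sigma> (\<Delta> @ \<Gamma>) (Bnd (i - length ss)) ((\<Delta> @ \<Gamma>) ! (i - length ss))"
      using 3 2 by (intro has_sort.intros(2)) auto
    moreover have "(\<Delta> @ \<Gamma>) ! (i - length ss) = (\<Delta> @ ss @ \<Gamma>) ! i"
      using 3 by (auto simp: nth_append diff_commute add.commute)
    ultimately show ?thesis using 3 len by auto
  qed
next
  case (3 f us s vs)
  then show ?case
    by (auto intro!: has_sort.intros simp: list_all2_map1 elim: list_all2_mono)
qed

lemma wf_form_inst:
  "wf_form \<Sigma> Q (\<Delta> @ ss @ \<Gamma>) \<phi> \<Longrightarrow> list_all2 (has_sort \<Sigma> []) ts ss \<Longrightarrow>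
   wf_form \<Sigma> Q (\<Delta> @ \<Gamma>) (inst (length \<Delta>) ts \<phi>)"
proof (induction \<phi> arbitrary: \<Delta>)
  case (FEq t u)
  then show ?case using has_sort_inst_tm by fastforce
next
  case (FAll rs \<phi>)
  \<comment> \<open>An inner block joins the intermediate context, in step with the depth counter of
    \<open>inst\<close>.\<close>
  then show ?case using FAll.IH[of "rs @ \<Delta>"] by (simp add: add.commute)
qed auto

text \<open>Substituting terms amounts to pushing their values onto the environment at the same
  depth. The sorting assumption in the empty context makes \<open>ts\<close> closed, so evaluating
  them under \<open>e1 @ e2\<close> or under \<open>[]\<close> gives the same values.\<close>

lemma eval_inst_tm:
  assumes "list_all2 (has_sort \<Sigma> []) ts ss"
  shows "eval I (e1 @ e2) (inst_tm (length e1) ts t) = eval I (e1 @ map (eval I []) ts @ e2) t"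
proof (induction t)
  case (Bnd i)
  consider "i < length e1" | "length e1 \<le> i" "i < length e1 + length ts" | "length e1 + length ts \<le> i"
    by linarith
  then show ?case
  proof cases
    case 2
    then have "has_sort \<Sigma> [] (ts ! (i - length e1)) (ss ! (i - length e1))"
      using assms by (auto simp: list_all2_conv_all_nth)
    moreover have "i - length e1 < length ts" using 2 by simp
    ultimately show ?thesis using 2 eval_closed[of \<Sigma> _ _ I "e1 @ e2"] by (simp add: nth_append)
  qed (auto simp: nth_append diff_commute add.commute)
next
  case (App f us)
  then have "map (\<lambda>u. eval I (e1 @ e2) (inst_tm (length e1) ts u)) us =
      map (\<lambda>u. eval I (e1 @ map (eval I []) ts @ e2) u) us" by simp
  then show ?case by (simp only: inst_tm.simps eval.simps map_map comp_def)
qed simp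

lemma holds_inst:
  assumes "list_all2 (has_sort \<Sigma> []) ts ss"
  shows "holds I (e1 @ e2) (inst (length e1) ts \<phi>) \<longleftrightarrow> holds I (e1 @ map (eval I []) ts @ e2) \<phi>"
proof (induction \<phi> arbitrary: e1)
  case (FEq t u)
  then show ?case by (simp add: eval_inst_tm[OF assms])
next
  case (FAll rs \<phi>)
  have "holds I (us @ e1 @ e2) (inst (length e1 + length rs) ts \<phi>) \<longleftrightarrow>
        holds I (us @ e1 @ map (eval I []) ts @ e2) \<phi>"
    if "sorted_tuple (fst I) rs us" for us
    using FAll.IH[of "us @ e1"] sorted_tuple_length[OF that] by (simp add: add.commute)
  then show ?case by auto
qed auto

lemma sat_inst:
  assumes "list_all2 (has_sort \<Sigma> []) ts ss"
  shows "sat I (inst 0 ts \<phi>) \<longleftrightarrow> holds I (map (eval I []) ts) \<phi>"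
  using holds_inst[OF assms, of I "[]" "[]" \<phi>] by simp

section \<open>Coincidence lemmas and free variables of instances\<close>

lemma eval_cong:
  "fst I = fst J \<Longrightarrow> \<forall>x \<in> fv_tm t. snd I x = snd J x \<Longrightarrow> eval I e t = eval J e t"
proof (induction t)
  case (App f ts)
  then have "map (eval I e) ts = map (eval J e) ts" by auto
  then show ?case using App.prems by (simp only: eval.simps)
qed auto

lemma holds_cong:
  "fst I = fst J \<Longrightarrow> \<forall>x \<in> fv \<phi>. snd I x = snd J x \<Longrightarrow> holds I e \<phi> \<longleftrightarrow> holds J e \<phi>"
proof (induction \<phi> arbitrary: e)
  case (FEq t u)
  then have "eval I e t = eval J e t" "eval I e u = eval J e u" by (auto intro!: eval_cong)
  then show ?case by simp
next
  case (FAll ss \<phi>)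
  then show ?case by simp
qed auto

lemma fv_inst_tm: "fv_tm (inst_tm d ts t) \<subseteq> fv_tm t \<union> \<Union> (fv_tm ` set ts)"
proof (induction t)
  case (Bnd i)
  have "fv_tm (ts ! (i - d)) \<subseteq> \<Union> (fv_tm ` set ts)" if "\<not> i < d" "i < d + length ts"
    using that by (intro UN_upper nth_mem) simp
  then show ?case by simp
next
  case (App f us)
  then show ?case by (simp add: UN_subset_iff) blast
qed simp

lemma fv_inst: "fv (inst d ts \<phi>) \<subseteq> fv \<phi> \<union> \<Union> (fv_tm ` set ts)"
proof (induction \<phi> arbitrary: d)
  case (FEq t u)
  then show ?case using fv_inst_tm[of d ts t] fv_inst_tm[of d ts u] by auto
next
  case (FAnd \<phi>1 \<phi>2)
  then show ?case using FAnd[of d] by auto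
next
  case (FOr \<phi>1 \<phi>2)
  then show ?case using FOr[of d] by auto
qed auto

lemma fv_inst_Free: "fv (inst d (map Free ks) \<phi>) \<subseteq> fv \<phi> \<union> set ks"
  using fv_inst[of d "map Free ks" \<phi>] by auto

text \<open>Guarantees that the values of a substitution form a tuple over which the quantifier
  ranges.\<close>

lemma eval_in_univ:
  assumes "is_interp T I" "is_struct (sig T) (fst I)"
  shows "has_sort (sig T) [] t s \<Longrightarrow> eval I [] t \<in> univ (fst I) s"
proof (induction rule: has_sort.induct)
  case (1 s n)
  then show ?case using assms(1) by (auto simp: is_interp_def)
next
  case (3 f ss s ts)
  then have "sorted_tuple (fst I) ss (map (eval I []) ts)"
    by (auto simp: sorted_tuple_def list_all2_conv_all_nth)
  then show ?case using 3 assms(2) unfolding is_struct_def by auto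
qed auto

section \<open>Clausal forms\<close>

text \<open>The type \<open>clause\<close> admits arbitrary formulas as atoms. Keeping this
  predicate invariant ensures that only equalities remain once no quantified atom is left.\<close>

definition is_atom :: "('s, 'f) form \<Rightarrow> bool" where
  "is_atom p \<longleftrightarrow> (\<exists>t u. p = FEq t u) \<or> is_quantified p"

lemma atoms_is_atom: "p \<in> atoms \<phi> \<Longrightarrow> is_atom p"
  by (induction \<phi>) (auto simp: is_atom_def is_quantified_def)

lemma fv_atoms: "p \<in> atoms \<phi> \<Longrightarrow> fv p \<subseteq> fv \<phi>"
  by (induction \<phi>) auto

lemma wf_atoms: "p \<in> atoms \<phi> \<Longrightarrow> wf_form \<Sigma> Q \<Gamma> \<phi> \<Longrightarrow> wf_form \<Sigma> Q \<Gamma> p"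
  by (induction \<phi>) auto

lemma prop_true_sat: "prop_true (sat I) \<phi> \<longleftrightarrow> sat I \<phi>"
  by (induction \<phi>) auto

text \<open>Specialises the propositional equivalence to the valuation \<open>sat I\<close>, for
  which propositional truth is satisfaction.\<close>

lemma clausal_form_sat: "clausal_form \<Phi> C \<Longrightarrow> sat_clauses I C \<longleftrightarrow> (\<forall>\<phi> \<in> \<Phi>. sat I \<phi>)"
  unfolding clausal_form_def by (simp add: prop_true_sat)

lemma clausal_form_atm:
  assumes "clausal_form \<Phi> C" "c \<in> C" "l \<in> c"
  obtains \<phi> where "\<phi> \<in> \<Phi>" "atm l \<in> atoms \<phi>"
proof -
  have "atm l \<in> atm ` \<Union>C" using assms(2,3) by blast
  then have "atm l \<in> \<Union> (atoms ` \<Phi>)" using assms(1) unfolding clausal_form_def by blast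
  then show thesis using that by blast
qed

lemma clausal_form_fv:
  assumes "clausal_form \<Phi> C" "c \<in> C" "l \<in> c"
  shows "fv (atm l) \<subseteq> \<Union> (fv ` \<Phi>)"
proof -
  obtain \<phi> where "\<phi> \<in> \<Phi>" "atm l \<in> atoms \<phi>" using clausal_form_atm[OF assms] .
  then show ?thesis using fv_atoms[of "atm l" \<phi>] by blast
qed

section \<open>Coincidence for clauses and definitions\<close>

lemma lit_true_cong: "(v (atm l) \<longleftrightarrow> w (atm l)) \<Longrightarrow> lit_true v l \<longleftrightarrow> lit_true w l"
  by (cases l) auto

lemma sat_lit_cong:
  "fst I = fst J \<Longrightarrow> \<forall>x \<in> fv (atm l). snd I x = snd J x \<Longrightarrow> sat_lit I l \<longleftrightarrow> sat_lit J l"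
  by (intro lit_true_cong holds_cong)

lemma sat_clauses_cong:
  assumes "fst I = fst J" "\<forall>x \<in> fv_clauses F. snd I x = snd J x"
  shows "sat_clauses I F \<longleftrightarrow> sat_clauses J F"
proof -
  have "sat_lit I l \<longleftrightarrow> sat_lit J l" if "c \<in> F" "l \<in> c" for c l
    using assms that by (intro sat_lit_cong) (auto simp: fv_clauses_def)
  then show ?thesis unfolding clauses_true_def by blast
qed

lemma fv_proxy: "fv (proxy a) = {a}"
  by (simp add: proxy_def)

lemma sat_defs_cong:
  assumes "fst I = fst J" "\<forall>x \<in> fv_defs A. snd I x = snd J x"
  shows "sat_defs I A \<longleftrightarrow> sat_defs J A"
proof -
  have "(sat I (proxy a) \<longleftrightarrow> sat J (proxy a)) \<and> (sat I q \<longleftrightarrow> sat J q)" if "(a, q) \<in> A" for a q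
    using assms that by (intro conjI holds_cong) (auto simp: fv_defs_def fv_proxy)
  then show ?thesis unfolding sat_defs_def by blast
qed

text \<open>A consistent set of literals entails a clause only by containing one of its literals,
  tautologies aside: otherwise the clause can be falsified without touching the set.\<close>

lemma consistent_entails_clause:
  assumes "\<forall>l \<in> M. lit_true v l" "\<forall>w. (\<forall>l \<in> M. lit_true w l) \<longrightarrow> clauses_true w F" "c \<in> F"
  shows "M \<inter> c \<noteq> {} \<or> (\<exists>p. Pos p \<in> c \<and> Neg p \<in> c)"
proof (rule ccontr)
  assume neg: "\<not> ?thesis"
  \<comment> \<open>\<open>w\<close> falsifies every literal of the non-tautological
    \<open>c\<close> and follows \<open>v\<close> elsewhere; as \<open>M\<close> is disjoint from
    \<open>c\<close>, its literals stay true.\<close>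
  define w where "w p = (if Pos p \<in> c then False else if Neg p \<in> c then True else v p)" for p
  have "lit_true w l" if "l \<in> M" for l
    using that assms(1) neg by (cases l) (auto simp: w_def)
  then have "\<exists>l \<in> c. lit_true w l"
    using assms(2,3) by (auto simp: clauses_true_def)
  then obtain l where "l \<in> c" "lit_true w l" by blast
  then show False using neg by (cases l) (auto simp: w_def split: if_splits)
qed

section \<open>Well-formedness under purification\<close>

text \<open>The counterpart of \<open>ground_clauses\<close> that still tolerates quantified atoms,
  hence can hold in the middle of purification.\<close>

definition wf_clauses :: "('s, 'f) sign \<Rightarrow> 's srt set \<Rightarrow> ('s, 'f) clause set \<Rightarrow> bool" where
  "wf_clauses \<Sigma> Q F \<longleftrightarrow>
     finite F \<and> (\<forall>c \<in> F. finite c \<and> (\<forall>l \<in> c. is_atom (atm l) \<and> wf_form \<Sigma> Q [] (atm l)))"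

definition wf_defs :: "('s, 'f) sign \<Rightarrow> 's srt set \<Rightarrow> ('s, 'f) defs \<Rightarrow> bool" where
  "wf_defs \<Sigma> Q A \<longleftrightarrow> (\<forall>(a, q) \<in> A. snd a = BoolS \<and> is_quantified q \<and> wf_form \<Sigma> Q [] q)"

lemma wf_clauses_lit:
  "wf_clauses \<Sigma> Q F \<Longrightarrow> c \<in> F \<Longrightarrow> l \<in> c \<Longrightarrow> is_atom (atm l) \<and> wf_form \<Sigma> Q [] (atm l)"
  by (auto simp: wf_clauses_def)

lemma clausal_form_wf:
  assumes "clausal_form \<Phi> C" "\<forall>\<phi> \<in> \<Phi>. wf_form \<Sigma> Q [] \<phi>"
  shows "wf_clauses \<Sigma> Q C"
proof -
  have "is_atom (atm l) \<and> wf_form \<Sigma> Q [] (atm l)" if "c \<in> C" "l \<in> c" for c l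
    using clausal_form_atm[OF assms(1) that] assms(2) by (metis atoms_is_atom wf_atoms)
  then show ?thesis using assms(1) by (auto simp: wf_clauses_def clausal_form_def)
qed

lemma wf_proxy:
  assumes "has_bool \<Sigma>" "snd a = BoolS"
  shows "wf_form \<Sigma> Q \<Gamma> (proxy a)"
proof -
  have "has_sort \<Sigma> \<Gamma> (Free a) BoolS"
    using assms has_sort.intros(1)[of BoolS \<Sigma> \<Gamma> "fst a"] by (cases a) (auto simp: has_bool_def)
  moreover have "has_sort \<Sigma> \<Gamma> (App TrueC []) BoolS"
    using assms by (auto simp: has_bool_def intro: has_sort.intros)
  ultimately show ?thesis by (auto simp: proxy_def)
qed

lemma has_sort_Free_list:
  "set ss \<subseteq> sorts \<Sigma> \<Longrightarrow> map snd ks = ss \<Longrightarrow> list_all2 (has_sort \<Sigma> []) (map Free ks) ss"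
proof (induction ks arbitrary: ss)
  case (Cons k ks)
  then show ?case by (cases k) (auto intro: has_sort.intros)
qed auto

lemma purify_step_wf:
  assumes "purify_step (U, F, A) (U', F', A')" "has_bool \<Sigma>" "wf_clauses \<Sigma> Q F" "wf_defs \<Sigma> Q A"
  shows "wf_clauses \<Sigma> Q F' \<and> wf_defs \<Sigma> Q A'"
  using assms(1)
proof cases
  case (positive G ss \<phi> a n)
  obtain c where "c \<in> F" "Pos (FAll ss \<phi>) \<in> c" using positive(4-6) by blast
  then have q: "wf_form \<Sigma> Q [] (FAll ss \<phi>)"
    using wf_clauses_lit[OF assms(3)] by fastforce
  have p: "wf_form \<Sigma> Q [] (proxy a)" "is_atom (proxy a)"
    using wf_proxy[OF assms(2)] positive(7) by (auto simp: proxy_def is_atom_def)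
  have "finite G" using positive(4) assms(3) by (auto simp: wf_clauses_def intro: finite_subset)
  then have "finite F'" unfolding positive(2) using assms(3) by (simp add: wf_clauses_def)
  then have "wf_clauses \<Sigma> Q F'"
    using p assms(3) positive(4) unfolding wf_clauses_def positive(2) by auto
  moreover have "wf_defs \<Sigma> Q A'"
    using positive(3,7) q assms(4) by (auto simp: wf_defs_def is_quantified_def)
  ultimately show ?thesis by simp
next
  case (negative G ss \<phi> ks D)
  obtain c where "c \<in> F" "Neg (FAll ss \<phi>) \<in> c" using negative(4-6) by blast
  then have q: "wf_form \<Sigma> Q [] (FAll ss \<phi>)"
    using wf_clauses_lit[OF assms(3)] by fastforce
  then have "list_all2 (has_sort \<Sigma> []) (map Free ks) ss"
    using negative(7) by (intro has_sort_Free_list) auto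
  then have "wf_form \<Sigma> Q [] (inst 0 (map Free ks) \<phi>)"
    using q wf_form_inst[of \<Sigma> Q "[]" ss "[]" \<phi>] by simp
  then have D: "wf_clauses \<Sigma> Q D" using negative(10) by (intro clausal_form_wf) auto
  have "finite G" using negative(4) assms(3) by (auto simp: wf_clauses_def intro: finite_subset)
  moreover have "finite D" using D by (simp add: wf_clauses_def)
  ultimately have "finite {(c - {Neg (FAll ss \<phi>)}) \<union> d | c d. c \<in> G \<and> d \<in> D}"
    by (intro finite_image_set2) simp_all
  then have "finite F'" unfolding negative(2) using assms(3) by (simp add: wf_clauses_def)
  then have "wf_clauses \<Sigma> Q F'"
    using D assms(3) negative(4) unfolding wf_clauses_def negative(2) by auto
  then show ?thesis using negative(3) assms(4) by simp
qed

text \<open>This invariant is what makes a variable outside \<open>U\<close> fresh for the current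
  clauses and definitions.\<close>

lemma purify_step_fv:
  assumes "purify_step (U, F, A) (U', F', A')" "fv_clauses F \<subseteq> U" "fv_defs A \<subseteq> U"
  shows "U \<subseteq> U' \<and> fv_clauses F' \<subseteq> U' \<and> fv_defs A' \<subseteq> U'"
proof -
  have F: "fv (atm l) \<subseteq> U" if "c \<in> F" "l \<in> c" for c l
    using that assms(2) by (auto simp: fv_clauses_def)
  show ?thesis
    using assms(1)
  proof cases
    case (positive G ss \<phi> a n)
    obtain c where "c \<in> F" "Pos (FAll ss \<phi>) \<in> c" using positive(4-6) by blast
    then have "fv \<phi> \<subseteq> U" using F by fastforce
    then have "fv_defs A' \<subseteq> U'"
      using assms(3) unfolding positive(1,3) by (auto simp: fv_defs_def)
    moreover have "fv (atm l) \<subseteq> U'" if "c \<in> F'" "l \<in> c" for c l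
      using that F positive(4) unfolding positive(1,2) by (auto simp: fv_proxy; blast)
    ultimately show ?thesis unfolding positive(1) fv_clauses_def by blast
  next
    case (negative G ss \<phi> ks D)
    obtain c where "c \<in> F" "Neg (FAll ss \<phi>) \<in> c" using negative(4-6) by blast
    then have "fv \<phi> \<subseteq> U" using F by fastforce
    then have "fv (atm l) \<subseteq> U'" if "d \<in> D" "l \<in> d" for d l
      using clausal_form_fv[OF negative(10) that] fv_inst_Free[of 0 ks \<phi>]
      unfolding negative(1) by auto
    then have "fv (atm l) \<subseteq> U'" if "c \<in> F'" "l \<in> c" for c l
      using that F negative(4) unfolding negative(1,2) by blast
    then show ?thesis using assms(3) unfolding negative(1,3) fv_clauses_def by blast
  qed
qed

section \<open>Purification preserves satisfiability\<close>

lemma interp_upd: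
  assumes "is_interp T I" "sorted_tuple (fst I) (map snd ks) us"
  shows "is_interp T (fst I, \<lambda>x. case map_of (zip ks us) x of None \<Rightarrow> snd I x | Some u \<Rightarrow> u)"
proof -
  have "u \<in> univ (fst I) s" if "map_of (zip ks us) (n, s) = Some u" for n s u
  proof -
    have "((n, s), u) \<in> set (zip ks us)" using that by (rule map_of_SomeD)
    then show ?thesis
      using assms(2) by (auto simp: sorted_tuple_def list_all2_conv_all_nth set_zip)
        (metis nth_map snd_conv)
  qed
  then show ?thesis using assms(1) by (auto simp: is_interp_def split: option.split)
qed

lemma map_of_zip_map:
  assumes "distinct ks" "length ks = length us"
  shows "map (\<lambda>x. case map_of (zip ks us) x of None \<Rightarrow> g x | Some u \<Rightarrow> u) ks = us"
  using assms by (intro nth_equalityI) (auto simp: map_of_zip_nth)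

text \<open>A fresh proxy receives the truth value of its formula; fresh Skolem variables receive a
  counterexample to theirs, if there is one. Agreement on \<open>U\<close> keeps the old clauses and
  definitions true.\<close>

lemma purify_step_sat:
  assumes "purify_step (U, F, A) (U', F', A')"
    and Sig: "has_bool (sig T)" and strct: "is_struct (sig T) (fst I)"
    and wf: "wf_clauses (sig T) Q F"
    and fv: "fv_clauses F \<subseteq> U" "fv_defs A \<subseteq> U"
    and I: "is_interp T I" "sat_clauses I F" "sat_defs I A"
  shows "\<exists>J. fst J = fst I \<and> (\<forall>x \<in> U. snd J x = snd I x) \<and>
     is_interp T J \<and> sat_clauses J F' \<and> sat_defs J A'"
  using assms(1)
proof cases
  case (positive G ss \<phi> a n)
  let ?q = "FAll ss \<phi>"
  \<comment> \<open>Since \<open>TrueC\<close> and \<open>FalseC\<close> denote different elements,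
    the proxy is equal to true exactly when the quantified formula holds.\<close>
  define b where "b = fint (fst I) (if sat I ?q then TrueC else FalseC) []"
  define J where "J = (fst I, (snd I)(a := b))"
  have "sorted_tuple (fst I) [] []" by (simp add: sorted_tuple_def)
  then have "b \<in> univ (fst I) BoolS"
    using Sig strct unfolding is_struct_def has_bool_def b_def by auto
  then have J: "is_interp T J" using I(1) positive(7) by (auto simp: is_interp_def J_def)
  have agree: "fst J = fst I" "\<forall>x \<in> U. snd J x = snd I x"
    using positive(8) by (auto simp: J_def)
  obtain c where "c \<in> F" "Pos ?q \<in> c" using positive(4-6) by blast
  then have "fv ?q \<subseteq> U" using fv(1) by (fastforce simp: fv_clauses_def)
  then have q: "sat J ?q \<longleftrightarrow> sat I ?q" using agree by (intro holds_cong) auto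
  have a: "sat J (proxy a) \<longleftrightarrow> sat I ?q"
    using strct Sig by (auto simp: proxy_def J_def b_def is_struct_def)
  have F: "sat_clauses J F"
    using I(2) sat_clauses_cong[of J I F] agree fv by auto
  have "sat_defs J A"
    using I(3) sat_defs_cong[of J I A] agree fv by auto
  then have "sat_defs J A'" using a q unfolding positive(3) sat_defs_def by blast
  moreover have "\<exists>l \<in> insert (Pos (proxy a)) (c - {Pos ?q}). sat_lit J l" if "c \<in> F" for c
  proof -
    obtain l where l: "l \<in> c" "sat_lit J l" using F \<open>c \<in> F\<close> by (auto simp: clauses_true_def)
    show ?thesis
    proof (cases "l = Pos ?q")
      case True
      then have "sat_lit J (Pos (proxy a))" using l(2) a q by (simp only: lit_true.simps)
      then show ?thesis by blast
    qed (use l in blast)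
  qed
  then have "sat_clauses J F'"
    using F positive(4) unfolding positive(2) clauses_true_def by blast
  ultimately show ?thesis using J agree by blast
next
  case (negative G ss \<phi> ks D)
  let ?q = "FAll ss \<phi>"
  show ?thesis
  proof (cases "sat I ?q")
    \<comment> \<open>The removed literal is false in \<open>I\<close>, so the rest of each clause
      is already true and \<open>I\<close> itself serves as witness.\<close>
    case True
    have "\<exists>l \<in> c - {Neg ?q}. sat_lit I l" if "c \<in> F" for c
    proof -
      obtain l where "l \<in> c" "sat_lit I l" using I(2) \<open>c \<in> F\<close> by (auto simp: clauses_true_def)
      moreover have "\<not> sat_lit I (Neg ?q)" using True by (simp only: lit_true.simps not_not)
      ultimately show ?thesis by blast
    qed
    then have "sat_clauses I F'"
      using I(2) negative(4) unfolding negative(2) clauses_true_def by blast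
    then show ?thesis using I negative(3) by auto
  next
    case False
    \<comment> \<open>The falsifying tuple \<open>us\<close> becomes the value of the Skolem
      variables \<open>ks\<close>.\<close>
    then obtain us where us: "sorted_tuple (fst I) ss us" "\<not> holds I us \<phi>" by auto
    have len: "length ks = length us"
      using sorted_tuple_length[OF us(1)] negative(7) by auto
    define J where
      "J = (fst I, \<lambda>x. case map_of (zip ks us) x of None \<Rightarrow> snd I x | Some u \<Rightarrow> u)"
    have J: "is_interp T J"
      unfolding J_def using I(1) us(1) negative(7) by (intro interp_upd) auto
    have "map_of (zip ks us) x = None" if "x \<in> U" for x
      using that negative(9) len by (auto simp: map_of_zip_is_None)
    then have agree: "fst J = fst I" "\<forall>x \<in> U. snd J x = snd I x"
      by (auto simp: J_def)
    obtain c where c: "c \<in> F" "Neg ?q \<in> c" using negative(4-6) by blast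
    then have qF: "wf_form (sig T) Q [] ?q"
      using wf_clauses_lit[OF wf] by fastforce
    then have ks: "list_all2 (has_sort (sig T) []) (map Free ks) ss"
      using negative(7) by (intro has_sort_Free_list) auto
    have "fv \<phi> \<subseteq> U" using c fv(1) by (fastforce simp: fv_clauses_def)
    \<comment> \<open>The body contains none of the fresh \<open>ks\<close>, so reassigning them
      leaves the counterexample intact.\<close>
    then have "holds J us \<phi> \<longleftrightarrow> holds I us \<phi>" using agree by (intro holds_cong) auto
    moreover have "map (eval J []) (map Free ks) = us"
      using map_of_zip_map[of ks us "snd I"] negative(8) len by (simp add: J_def comp_def)
    ultimately have "\<not> sat J (inst 0 (map Free ks) \<phi>)"
      using sat_inst[OF ks, of J \<phi>] us(2) by simp
    then have D: "sat_clauses J D"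
      using clausal_form_sat[OF negative(10), of J] by simp
    have F: "sat_clauses J F"
      using I(2) sat_clauses_cong[of J I F] agree fv by auto
    have "sat_defs J A"
      using I(3) sat_defs_cong[of J I A] agree fv by auto
    moreover have "\<exists>l \<in> (c - {Neg ?q}) \<union> d. sat_lit J l" if "d \<in> D" for c d
      using D that unfolding clauses_true_def by blast
    then have "sat_clauses J F'"
      using F unfolding negative(2) clauses_true_def by blast
    ultimately show ?thesis using J agree unfolding negative(3) by blast
  qed
qed

lemma purify_steps_sat:
  assumes "purify_step\<^sup>*\<^sup>* (U, F, A) (U', F', A')"
    and "has_bool (sig T)" "is_struct (sig T) (fst I)"
    and "wf_clauses (sig T) Q F" "wf_defs (sig T) Q A"
    and "fv_clauses F \<subseteq> U" "fv_defs A \<subseteq> U"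
    and "is_interp T I" "sat_clauses I F" "sat_defs I A"
  shows "\<exists>J. fst J = fst I \<and> (\<forall>x \<in> U. snd J x = snd I x) \<and>
     is_interp T J \<and> sat_clauses J F' \<and> sat_defs J A'"
  using assms
proof (induction "(U, F, A)" arbitrary: U F A I rule: converse_rtranclp_induct)
  case base
  then show ?case by blast
next
  case (step y)
  obtain U1 F1 A1 where y: "y = (U1, F1, A1)" by (cases y) auto
  note st = step(1)[unfolded y]
  obtain J where J: "fst J = fst I" "\<forall>x \<in> U. snd J x = snd I x" "is_interp T J"
    "sat_clauses J F1" "sat_defs J A1"
    using purify_step_sat[OF st step.prems(1,2,3,5,6,7,8,9)] by blast
  have "wf_clauses (sig T) Q F1 \<and> wf_defs (sig T) Q A1"
    using purify_step_wf[OF st step.prems(1,3,4)] .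
  moreover have sub: "U \<subseteq> U1 \<and> fv_clauses F1 \<subseteq> U1 \<and> fv_defs A1 \<subseteq> U1"
    using purify_step_fv[OF st step.prems(5,6)] .
  ultimately obtain K where "fst K = fst J" "\<forall>x \<in> U1. snd K x = snd J x" "is_interp T K"
    "sat_clauses K F'" "sat_defs K A'"
    using step.hyps(3)[OF y step.prems(1), of J] step.prems(2) J by auto
  then show ?case using J sub by (intro exI[of _ K]) auto
qed

lemma purify_steps_wf:
  assumes "purify_step\<^sup>*\<^sup>* (U, F, A) (U', F', A')" "has_bool \<Sigma>" "wf_clauses \<Sigma> Q F" "wf_defs \<Sigma> Q A"
  shows "wf_clauses \<Sigma> Q F' \<and> wf_defs \<Sigma> Q A'"
  using assms
proof (induction "(U, F, A)" arbitrary: U F A rule: converse_rtranclp_induct)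
  case (step y)
  obtain U1 F1 A1 where y: "y = (U1, F1, A1)" by (cases y) auto
  show ?case
    using purify_step_wf[OF step(1)[unfolded y] step.prems] step.hyps(3)[OF y step.prems(1)] by blast
qed auto

lemma purify_wf:
  assumes "purify X \<Phi> F A" "has_bool \<Sigma>" "\<forall>\<phi> \<in> \<Phi>. wf_form \<Sigma> Q [] \<phi>"
  shows "wf_clauses \<Sigma> Q F" "wf_defs \<Sigma> Q A" "ground_clauses \<Sigma> F"
proof -
  obtain C U where C: "clausal_form \<Phi> C"
    "purify_step\<^sup>*\<^sup>* (X \<union> \<Union> (fv ` \<Phi>), C, {}) (U, F, A)"
    "\<forall>c \<in> F. \<forall>l \<in> c. \<not> is_quantified (atm l)"
    using assms(1) unfolding purify_def by blast
  have "wf_clauses \<Sigma> Q C" using clausal_form_wf C(1) assms(3) by blast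
  moreover have "wf_defs \<Sigma> Q {}" by (simp add: wf_defs_def)
  ultimately show wf: "wf_clauses \<Sigma> Q F" "wf_defs \<Sigma> Q A"
    using purify_steps_wf[OF C(2) assms(2)] by auto
  \<comment> \<open>Purification stops only when no atom is quantified, which leaves well-sorted
    equalities.\<close>
  have "ground_literal \<Sigma> l" if l: "c \<in> F" "l \<in> c" for c l
  proof -
    obtain t u where "atm l = FEq t u"
      using wf_clauses_lit[OF wf(1) l] C(3) l unfolding is_atom_def by blast
    then show ?thesis
      using wf_clauses_lit[OF wf(1) l] by (auto simp: ground_literal_def)
  qed
  then show "ground_clauses \<Sigma> F" using wf(1) by (auto simp: ground_clauses_def wf_clauses_def)
qed

text \<open>\<open>X\<close> will hold the variables of the surrounding state: agreement on
  \<open>X\<close> lets the new model keep satisfying it.\<close>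

lemma purify_sat:
  assumes "purify X \<Phi> F A" "has_bool (sig T)" "is_struct (sig T) (fst I)"
    and "\<forall>\<phi> \<in> \<Phi>. wf_form (sig T) Q [] \<phi>"
    and "is_interp T I" "\<forall>\<phi> \<in> \<Phi>. sat I \<phi>"
  shows "\<exists>J. fst J = fst I \<and> (\<forall>x \<in> X. snd J x = snd I x) \<and>
     is_interp T J \<and> sat_clauses J F \<and> sat_defs J A"
proof -
  obtain C U where C: "clausal_form \<Phi> C"
    "purify_step\<^sup>*\<^sup>* (X \<union> \<Union> (fv ` \<Phi>), C, {}) (U, F, A)"
    using assms(1) unfolding purify_def by blast
  have wf: "wf_clauses (sig T) Q C" "wf_defs (sig T) Q {}"
    using clausal_form_wf[OF C(1) assms(4)] by (auto simp: wf_defs_def)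
  have fv: "fv_clauses C \<subseteq> X \<union> \<Union> (fv ` \<Phi>)" "fv_defs {} \<subseteq> X \<union> \<Union> (fv ` \<Phi>)"
    using clausal_form_fv[OF C(1)] unfolding fv_clauses_def fv_defs_def by blast+
  have "sat_clauses I C" "sat_defs I {}"
    using clausal_form_sat[OF C(1), of I] assms(6) by (simp_all add: sat_defs_def)
  then show ?thesis
    using purify_steps_sat[OF C(2) assms(2,3) wf fv assms(5)] by blast
qed

section \<open>Refutational soundness\<close>

text \<open>Each clause "not \<open>a\<close> or instance" follows from the equivalence for
  \<open>a\<close> in \<open>A\<close>, so a model of \<open>F\<close> and \<open>A\<close>
  satisfies the instances before they are purified; purification then changes fresh variables
  only.\<close>

lemma T_satisfiable_add_instances:
  assumes Sig: "has_bool (sig T)" and strct: "\<forall>S \<in> models T. is_struct (sig T) S"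
    and F: "ground_clauses (sig T) F" and A: "wf_defs (sig T) Q A" and "T_satisfiable T F A"
    and a: "(a, FAll ss \<phi>) \<in> A" and \<Theta>: "\<Theta> \<subseteq> substs (sig T) V ss"
    and pur: "purify (fv_clauses F \<union> fv_defs A)
      {FOr (FNot (proxy a)) (inst 0 \<sigma> \<phi>) | \<sigma>. \<sigma> \<in> \<Theta>} F' A'"
  shows "ground_clauses (sig T) (F \<union> F')" "wf_defs (sig T) Q (A \<union> A')"
    "T_satisfiable T (F \<union> F') (A \<union> A')"
proof -
  let ?\<Phi> = "{FOr (FNot (proxy a)) (inst 0 \<sigma> \<phi>) | \<sigma>. \<sigma> \<in> \<Theta>}"
  have sorted: "list_all2 (has_sort (sig T) []) \<sigma> ss" if "\<sigma> \<in> \<Theta>" for \<sigma>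
    using \<Theta> that by (auto simp: substs_def)
  have wfa: "snd a = BoolS" "wf_form (sig T) Q ss \<phi>"
    using A a by (auto simp: wf_defs_def)
  have "wf_form (sig T) Q [] (inst 0 \<sigma> \<phi>)" if "\<sigma> \<in> \<Theta>" for \<sigma>
    using wf_form_inst[of "sig T" Q "[]" ss "[]" \<phi> \<sigma>] sorted[OF that] wfa by simp
  then have wf: "\<forall>\<phi> \<in> ?\<Phi>. wf_form (sig T) Q [] \<phi>"
    using wf_proxy[OF Sig wfa(1)] by auto
  show "ground_clauses (sig T) (F \<union> F')" "wf_defs (sig T) Q (A \<union> A')"
    using purify_wf[OF pur Sig wf] F A by (auto simp: ground_clauses_def wf_defs_def)
  obtain I where I: "is_interp T I" "sat_clauses I F" "sat_defs I A"
    using assms(5) by (auto simp: T_satisfiable_def)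
  have S: "is_struct (sig T) (fst I)" using I(1) strct by (auto simp: is_interp_def)
  have "sat I (inst 0 \<sigma> \<phi>)" if "\<sigma> \<in> \<Theta>" "sat I (proxy a)" for \<sigma>
  proof -
    have "sorted_tuple (fst I) ss (map (eval I []) \<sigma>)"
      using sorted[OF that(1)] eval_in_univ[OF I(1) S]
      by (auto simp: sorted_tuple_def list_all2_conv_all_nth)
    moreover have "sat I (FAll ss \<phi>)" using I(3) a that(2) unfolding sat_defs_def by blast
    ultimately show ?thesis unfolding sat_inst[OF sorted[OF that(1)]] by auto
  qed
  then have "\<forall>\<phi> \<in> ?\<Phi>. sat I \<phi>" by auto
  then obtain J where J: "fst J = fst I" "\<forall>x \<in> fv_clauses F \<union> fv_defs A. snd J x = snd I x"
    "is_interp T J" "sat_clauses J F'" "sat_defs J A'"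
    using purify_sat[OF pur Sig S wf I(1)] by blast
  have "sat_clauses J F" "sat_defs J A"
    using I J(1,2) sat_clauses_cong[of J I F] sat_defs_cong[of J I A] by auto
  then have "sat_clauses J (F \<union> F')" "sat_defs J (A \<union> A')"
    using J(4,5) unfolding clauses_true_def sat_defs_def ball_Un by blast+
  then show "T_satisfiable T (F \<union> F') (A \<union> A')"
    using J(3) unfolding T_satisfiable_def by blast
qed

text \<open>The pending equivalences \<open>P\<close> stay among the current definitions, since the
  latter only grow; hence the instances added at each iteration are consequences of the state
  reached.\<close>

lemma step3_T_satisfiable:
  assumes "step3 (sig T) V h P FA FA'"
    and Sig: "has_bool (sig T)" and strct: "\<forall>S \<in> models T. is_struct (sig T) S"
  shows "P \<subseteq> snd FA \<Longrightarrow> ground_clauses (sig T) (fst FA) \<Longrightarrow> wf_defs (sig T) Q (snd FA) \<Longrightarrow>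
    T_satisfiable T (fst FA) (snd FA) \<Longrightarrow>
    ground_clauses (sig T) (fst FA') \<and> wf_defs (sig T) Q (snd FA') \<and>
    T_satisfiable T (fst FA') (snd FA')"
  using assms(1)
proof (induction rule: step3.induct)
  case (1 F A)
  then show ?case by simp
next
  case (2 a ss \<phi> P \<Theta> F A F' A' F'' A'')
  have a: "(a, FAll ss \<phi>) \<in> A" using 2 by auto
  note add = T_satisfiable_add_instances[OF Sig strct _ _ _ a 2(3,4),
      OF 2(8-10)[unfolded fst_conv snd_conv]]
  show ?case by (rule 2(6)) (use add 2(7) in auto)
qed

text \<open>Read backwards along the run: the last state is refuted by the sound Step 1, and
  satisfiability of an earlier state would have carried over to it. Groundness is maintained because
  soundness of Step 1 is only assumed for ground clauses.\<close>

lemma FM_Solve_Unsat: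
  assumes "FM_Solve Ts step1 H F A r"
    and Sig: "has_bool (sign_union Ts)" and sound: "sound_step1 (thry_union Ts) step1"
  shows "r = Unsat \<Longrightarrow> ground_clauses (sign_union Ts) F \<Longrightarrow> wf_defs (sign_union Ts) Q A \<Longrightarrow>
    \<not> T_satisfiable (thry_union Ts) F A"
  using assms(1)
proof (induction rule: FM_Solve.induct)
  case (unsat F A)
  then show ?case using sound
    by (auto simp: sound_step1_def T_satisfiable_def T_satisfiable_clauses_def thry_union_def)
next
  case (loop F M I V A F' A' r)
  have sg: "sig (thry_union Ts) = sign_union Ts" by (simp add: thry_union_def)
  have strct: "\<forall>S \<in> models (thry_union Ts). is_struct (sign_union Ts) S"
    by (simp add: thry_union_def)
  have "active A M \<subseteq> A" by (auto simp: active_def)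
  then show ?case
    using step3_T_satisfiable[of "thry_union Ts" V "H I V" "active A M" "(F, A)" "(F', A')" Q]
      loop(6,8,9,10,11) Sig strct unfolding sg fst_conv snd_conv by blast
qed simp

section \<open>Model soundness\<close>

text \<open>The syntactic condition under which proxies can be reassigned freely: other literals and
  all bodies keep their truth value, and each proxy has one body to follow. The clauses added by
  Step 3 can break it through their negated proxies.\<close>

definition proxies_isolated :: "('s, 'f) clause set \<Rightarrow> ('s, 'f) defs \<Rightarrow> bool" where
  "proxies_isolated F A \<longleftrightarrow>
     (\<forall>c \<in> F. \<forall>l \<in> c. fv (atm l) \<inter> fst ` A = {} \<or> (\<exists>a \<in> fst ` A. l = Pos (proxy a))) \<and>
     (\<forall>(a, q) \<in> A. fv q \<inter> fst ` A = {}) \<and>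
     (\<forall>a q q'. (a, q) \<in> A \<longrightarrow> (a, q') \<in> A \<longrightarrow> q = q')"

lemma proxies_isolated_lit:
  "proxies_isolated F A \<Longrightarrow> c \<in> F \<Longrightarrow> l \<in> c \<Longrightarrow>
   fv (atm l) \<inter> fst ` A = {} \<or> (\<exists>a \<in> fst ` A. l = Pos (proxy a))"
  unfolding proxies_isolated_def by blast

lemma proxies_isolated_body: "proxies_isolated F A \<Longrightarrow> (a, q) \<in> A \<Longrightarrow> fv q \<inter> fst ` A = {}"
  unfolding proxies_isolated_def by blast

lemma purify_step_isolated:
  assumes "purify_step (U, F, A) (U', F', A')" "fv_clauses F \<subseteq> U" "fv_defs A \<subseteq> U"
    and iso: "proxies_isolated F A"
  shows "proxies_isolated F' A'"
  using assms(1)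
proof cases
  case (positive G ss \<phi> a n)
  obtain c where c: "c \<in> F" "Pos (FAll ss \<phi>) \<in> c" using positive(4-6) by blast
  \<comment> \<open>A quantified atom is not a proxy equality, so the first alternative of the
    invariant applies.\<close>
  have "fv (FAll ss \<phi>) \<inter> fst ` A = {}"
    using proxies_isolated_lit[OF iso c] by (auto simp: proxy_def)
  moreover have "fv (FAll ss \<phi>) \<subseteq> U"
    using c assms(2) by (fastforce simp: fv_clauses_def)
  ultimately have q: "fv (FAll ss \<phi>) \<inter> insert a (fst ` A) = {}" using positive(8) by blast
  have aA: "a \<notin> fst ` A" "\<forall>(b, q) \<in> A. a \<notin> fv q"
    using positive(8) assms(3) by (auto simp: fv_defs_def)
  have fstA: "fst ` A' = insert a (fst ` A)" unfolding positive(3) by simp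
  have "fv (atm l) \<inter> fst ` A' = {} \<or> (\<exists>b \<in> fst ` A'. l = Pos (proxy b))"
    if "c \<in> F" "l \<in> c" for c l
  proof -
    have "a \<notin> fv (atm l)" using that positive(8) assms(2) by (auto simp: fv_clauses_def)
    then show ?thesis using iso that unfolding proxies_isolated_def fstA by blast
  qed
  then have "\<forall>c \<in> F'. \<forall>l \<in> c. fv (atm l) \<inter> fst ` A' = {} \<or> (\<exists>b \<in> fst ` A'. l = Pos (proxy b))"
    using positive(4) unfolding positive(2) fstA by blast
  moreover have "fv q' \<inter> fst ` A' = {}" if "(b, q') \<in> A'" for b q'
  proof (cases "(b, q') \<in> A")
    case True
    then show ?thesis using proxies_isolated_body[OF iso True] aA(2) unfolding fstA by blast
  next
    case False
    then have "q' = FAll ss \<phi>" using that unfolding positive(3) by blast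
    then show ?thesis using q unfolding fstA by blast
  qed
  moreover have "\<forall>b q q'. (b, q) \<in> A' \<longrightarrow> (b, q') \<in> A' \<longrightarrow> q = q'"
  proof -
    have "(a, q) \<notin> A" for q using aA(1) by force
    then show ?thesis using iso unfolding proxies_isolated_def positive(3) by blast
  qed
  ultimately show ?thesis unfolding proxies_isolated_def by blast
next
  case (negative G ss \<phi> ks D)
  obtain c where c: "c \<in> F" "Neg (FAll ss \<phi>) \<in> c" using negative(4-6) by blast
  have "fv \<phi> \<inter> fst ` A = {}"
    using proxies_isolated_lit[OF iso c] by auto
  \<comment> \<open>Proxies lie in \<open>U\<close>, so Skolem variables are never proxies.\<close>
  moreover have "set ks \<inter> fst ` A = {}"
    using negative(9) assms(3) by (fastforce simp: fv_defs_def)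
  ultimately have "fv (atm l) \<inter> fst ` A = {}" if "d \<in> D" "l \<in> d" for d l
    using clausal_form_fv[OF negative(10) that] fv_inst_Free[of 0 ks \<phi>] by auto
  then have "\<forall>c \<in> F'. \<forall>l \<in> c. fv (atm l) \<inter> fst ` A = {} \<or> (\<exists>a \<in> fst ` A. l = Pos (proxy a))"
    using iso negative(4) unfolding proxies_isolated_def negative(2) by blast
  then show ?thesis using iso unfolding proxies_isolated_def negative(3) by blast
qed

lemma purify_steps_isolated:
  assumes "purify_step\<^sup>*\<^sup>* (U, F, A) (U', F', A')" "fv_clauses F \<subseteq> U" "fv_defs A \<subseteq> U"
    and "proxies_isolated F A"
  shows "proxies_isolated F' A'"
  using assms
proof (induction "(U, F, A)" arbitrary: U F A rule: converse_rtranclp_induct)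
  case (step y)
  obtain U1 F1 A1 where y: "y = (U1, F1, A1)" by (cases y) auto
  show ?case
    using purify_step_fv[OF step(1)[unfolded y] step.prems(1,2)]
      purify_step_isolated[OF step(1)[unfolded y] step.prems] step.hyps(3)[OF y] by blast
qed auto

lemma purify_isolated:
  assumes "purify X \<Phi> F A"
  shows "proxies_isolated F A"
proof -
  obtain C U where C: "clausal_form \<Phi> C"
    "purify_step\<^sup>*\<^sup>* (X \<union> \<Union> (fv ` \<Phi>), C, {}) (U, F, A)"
    using assms unfolding purify_def by blast
  have "fv_clauses C \<subseteq> X \<union> \<Union> (fv ` \<Phi>)"
    using clausal_form_fv[OF C(1)] unfolding fv_clauses_def by blast
  moreover have "fv_defs {} \<subseteq> X \<union> \<Union> (fv ` \<Phi>)" by (simp add: fv_defs_def)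
  moreover have "proxies_isolated C {}" by (simp add: proxies_isolated_def)
  ultimately show ?thesis using purify_steps_isolated[OF C(2)] by blast
qed

section \<open>From the last round back to the initial state\<close>

lemma step3_mono:
  "step3 \<Sigma> V h P FA FA' \<Longrightarrow> fst FA \<subseteq> fst FA' \<and> snd FA \<subseteq> snd FA'"
  by (induction rule: step3.induct) auto

lemma FM_Solve_Sat_final_state:
  "FM_Solve Ts step1 H F A r \<Longrightarrow> r = Sat \<Longrightarrow>
   \<exists>F' A' M I V. F \<subseteq> F' \<and> A \<subseteq> A' \<and> satisfying_assignment (thry_union Ts) M F' \<and>
     step2_result Ts I V \<and> (\<forall>l \<in> M. sat_lit I l) \<and> (\<forall>(a, q) \<in> active A' M. H I V q = {})"
proof (induction rule: FM_Solve.induct)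
  case (sat F M I V A)
  then show ?case by blast
next
  case (loop F M I V A F' A' r)
  have "F \<subseteq> F'" "A \<subseteq> A'" using step3_mono[OF loop(6)] by auto
  then show ?case using loop(8)[OF loop(9)] by (meson order_trans)
qed simp

text \<open>\<open>F\<close> and \<open>A\<close> are meant to be the initial state, while
  \<open>M\<close> may come from a later round; all that links them is entailment of
  \<open>F\<close> and truth of the active bodies.\<close>

lemma T_satisfiable_of_active:
  assumes Sig: "has_bool (sig T)" and S: "is_struct (sig T) (fst I)" and I: "is_interp T I"
    and iso: "proxies_isolated F A" and A: "wf_defs (sig T) Q A"
    and M: "\<forall>l \<in> M. sat_lit I l" "\<forall>v. (\<forall>l \<in> M. lit_true v l) \<longrightarrow> clauses_true v F"
    and act: "\<forall>(a, q) \<in> active A M. sat I q"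
  shows "T_satisfiable T F A"
proof -
  \<comment> \<open>\<open>J\<close> gives each proxy the truth value in \<open>I\<close> of its
    body, which is unique by \<open>iso\<close>.\<close>
  define J where "J = (fst I, \<lambda>a. if a \<in> fst ` A
    then fint (fst I) (if \<exists>q. (a, q) \<in> A \<and> sat I q then TrueC else FalseC) [] else snd I a)"
  have "sorted_tuple (fst I) [] []" by (simp add: sorted_tuple_def)
  then have bool: "fint (fst I) TrueC [] \<in> univ (fst I) BoolS" "fint (fst I) FalseC [] \<in> univ (fst I) BoolS"
    "fint (fst I) TrueC [] \<noteq> fint (fst I) FalseC []"
    using Sig S unfolding is_struct_def has_bool_def by auto
  have "snd J (n, s) \<in> univ (fst I) s" if "s \<in> sorts (sig T)" for n s
  proof (cases "(n, s) \<in> fst ` A")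
    case True
    then have "s = BoolS" using A by (auto simp: wf_defs_def)
    then show ?thesis using True bool(1,2) by (simp add: J_def)
  next
    case False
    then show ?thesis using I that by (simp add: is_interp_def J_def)
  qed
  then have J: "is_interp T J" using I by (simp add: is_interp_def J_def)
  have agree: "fst J = fst I" "\<And>x. x \<notin> fst ` A \<Longrightarrow> snd J x = snd I x" by (auto simp: J_def)
  have a: "sat J (proxy a) \<longleftrightarrow> sat I q" if "(a, q) \<in> A" for a q
  proof -
    have "(\<exists>q. (a, q) \<in> A \<and> sat I q) \<longleftrightarrow> sat I q"
      using iso that unfolding proxies_isolated_def by blast
    moreover have "a \<in> fst ` A" using that by force
    ultimately show ?thesis using bool(3) by (simp add: proxy_def J_def)
  qed
  have q: "sat J q \<longleftrightarrow> sat I q" if "(a, q) \<in> A" for a q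
  proof -
    have "\<forall>x \<in> fv q. snd J x = snd I x" using proxies_isolated_body[OF iso that] agree(2) by blast
    then show ?thesis using agree(1) by (intro holds_cong)
  qed
  have "sat_defs J A" using a q by (auto simp: sat_defs_def)
  moreover have "\<exists>l \<in> c. sat_lit J l" if c: "c \<in> F" for c
  proof -
    consider l where "l \<in> M" "l \<in> c" | p where "Pos p \<in> c" "Neg p \<in> c"
      using consistent_entails_clause[OF M c] by blast
    then show ?thesis
    proof cases
      case 1
      then consider "fv (atm l) \<inter> fst ` A = {}" | b q where "(b, q) \<in> A" "l = Pos (proxy b)"
        using proxies_isolated_lit[OF iso c \<open>l \<in> c\<close>] by auto
      then have "sat_lit J l"
      proof cases
        case 1
        then have "\<forall>x \<in> fv (atm l). snd J x = snd I x" using agree(2) by blast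
        then have "sat_lit J l \<longleftrightarrow> sat_lit I l" using agree(1) by (intro sat_lit_cong)
        then show ?thesis using M(1) \<open>l \<in> M\<close> by blast
      next
        \<comment> \<open>The proxy belongs to \<open>M\<close>, hence is active: its body holds in
          \<open>I\<close>, and \<open>J\<close> makes the proxy true.\<close>
        case (2 b q)
        then have "sat I q" using act \<open>l \<in> M\<close> unfolding active_def by blast
        then show ?thesis using a 2 by simp
      qed
      then show ?thesis using 1 by blast
    next
      case 2
      then show ?thesis by (metis lit_true.simps)
    qed
  qed
  ultimately show ?thesis using J unfolding T_satisfiable_def clauses_true_def by blast
qed

theorem theorem2:
  fixes Ts :: "('s, 'f, 'u) thry list"
    and \<psi> :: "('s, 'f) form"
    and F :: "('s, 'f) clause set"
    and A :: "('s, 'f) defs"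
    and step1 :: "('s, 'f) step1_method"
    and H :: "('s, 'f, 'u) heuristic"
  assumes "\<forall>T \<in> set Ts. is_thry T"
    and "compatible Ts"
    and "has_bool (sign_union Ts)"
    and "input_form Ts \<psi>"
    and "purify {} {\<psi>} F A"
  shows "(sound_step1 (thry_union Ts) step1 \<longrightarrow>
            FM_Solve Ts step1 H F A Unsat \<longrightarrow> \<not> T_satisfiable (thry_union Ts) F A) \<and>
         (empty_only_if_true Ts H \<longrightarrow>
            FM_Solve Ts step1 H F A Sat \<longrightarrow> T_satisfiable (thry_union Ts) F A)"
proof (intro conjI impI)
  let ?T = "thry_union Ts" and ?Q = "quant_sorts Ts"
  have sg: "sig ?T = sign_union Ts" by (simp add: thry_union_def)
  have wf: "wf_defs (sign_union Ts) ?Q A" "ground_clauses (sign_union Ts) F"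
    using purify_wf[OF assms(5,3)] assms(4) by (auto simp: input_form_def)
  {
    assume "sound_step1 ?T step1" "FM_Solve Ts step1 H F A Unsat"
    then show "\<not> T_satisfiable ?T F A"
      using FM_Solve_Unsat assms(3) wf by blast
  }
  assume H: "empty_only_if_true Ts H" and "FM_Solve Ts step1 H F A Sat"
  then obtain F' A' M I V where fin: "F \<subseteq> F'" "A \<subseteq> A'" "satisfying_assignment ?T M F'"
    "step2_result Ts I V" "\<forall>l \<in> M. sat_lit I l" "\<forall>(a, q) \<in> active A' M. H I V q = {}"
    using FM_Solve_Sat_final_state[of Ts step1 H F A Sat] by blast
  have I: "is_interp ?T I" using fin(4) by (simp add: step2_result_def)
  then have S: "is_struct (sign_union Ts) (fst I)" by (simp add: is_interp_def thry_union_def)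
  have ent: "\<forall>v. (\<forall>l \<in> M. lit_true v l) \<longrightarrow> clauses_true v F"
    using fin(1,3) unfolding satisfying_assignment_def clauses_true_def by blast
  have "sat I q" if "(a, q) \<in> active A M" for a q
  proof -
    have "(a, q) \<in> A" using that by (simp add: active_def)
    then obtain ss \<phi> where "q = FAll ss \<phi>" "input_form Ts q"
      using wf(1) by (auto simp: wf_defs_def is_quantified_def input_form_def)
    \<comment> \<open>A definition of \<open>A\<close> that is active under \<open>M\<close> is also
      active in the larger \<open>A'\<close>, where the heuristic returned nothing.\<close>
    moreover have "H I V q = {}" using fin(2,6) that unfolding active_def by blast
    ultimately show ?thesis using H fin(4) unfolding empty_only_if_true_def by blast
  qed
  then show "T_satisfiable ?T F A"
    using T_satisfiable_of_active[of ?T I F A ?Q M] assms(3) S I purify_isolated[OF assms(5)]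
      wf(1) fin(5) ent unfolding sg by blast
qed

end
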